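(* Let $n,m\ge 1$ and $p\ge 2$ be integers and let $A$ be an $n\times m$ matrix with entries in $[p]=\{0,1,\ldots,p-1\}$. Then: (a) If $X_1,X_2,\ldots,X_s$ are $n\times n$ transposition matrices such that $$r(X_1X_2\cdots X_sA)>r(X_2X_3\cdots X_sA)>\cdots>r(X_{s-1}X_sA)>r(X_sA)>r(A),$$ then $c(X_1X_2\cdots X_sA)>c(A)$. (b) If $Y_1,Y_2,\ldots,Y_t$ are $m\times m$ transposition matrices such that $$c(AY_1Y_2\cdots Y_t)>c(AY_1Y_2\cdots Y_{t-1})>\cdots>c(AY_1Y_2)>c(AY_1)>c(A),$$ then $r(AY_1Y_2\cdots Y_t)>r(A)$.
   Context: For $A=(a_{ij})$ an $n\times m$ matrix with entries in $[p]$, put $x_i=\sum_{j=1}^m a_{ij}p^{m-j}$ ($i=1,\ldots,n$) and $y_j=\sum_{i=1}^n a_{ij}p^{n-i}$ ($j=1,\ldots,m$). Define the ordered tuples $r(A)=\langle x_1,\ldots,x_n\rangle$ and $c(A)=\langle y_1,\ldots,y_m\rangle$. Tuples of integers of the same length are compared with the lexicographic order. A transposition matrix is a matrix obtained from the identity matrix by interchanging exactly two rows; multiplying a matrix on the left by an $n\times n$ transposition swaps two of its rows, multiplying on the right by an $m\times m$ transposition swaps two of its columns. *)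

theory Defs
  imports Jordan_Normal_Form.Gauss_Jordan_Elimination "HOL-Library.List_Lexorder"
begin

text \<open>
  Matrix indices are 0-based, so the exponents \<open>m - j\<close> and \<open>n - i\<close> of the usual 1-based
  indexing become \<open>dim_col A - Suc j\<close> and \<open>dim_row A - Suc i\<close>. Tuples are lists, whose
  order \<open><\<close> is the lexicographic one from \<open>List_Lexorder\<close>.
\<close>

definition row_tuple :: "nat \<Rightarrow> nat mat \<Rightarrow> nat list" where
  "row_tuple p A =
     map (\<lambda>i. \<Sum>j<dim_col A. A $$ (i, j) * p ^ (dim_col A - Suc j)) [0..<dim_row A]"

definition col_tuple :: "nat \<Rightarrow> nat mat \<Rightarrow> nat list" where
  "col_tuple p A =
     map (\<lambda>j. \<Sum>i<dim_row A. A $$ (i, j) * p ^ (dim_row A - Suc i)) [0..<dim_col A]"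

definition transposition_matrix :: "nat \<Rightarrow> nat mat \<Rightarrow> bool" where
  "transposition_matrix n X \<longleftrightarrow> (\<exists>k l. k < n \<and> l < n \<and> k \<noteq> l \<and> X = swaprows k l (1\<^sub>m n))"

text \<open>
  For \<open>Xs = [X\<^sub>1, \<dots>, X\<^sub>s]\<close> and \<open>Ys = [Y\<^sub>1, \<dots>, Y\<^sub>t]\<close>, these are
  \<open>X\<^sub>1 * (X\<^sub>2 * (\<dots> * (X\<^sub>s * A)))\<close> and \<open>A * Y\<^sub>1 * Y\<^sub>2 * \<dots> * Y\<^sub>t\<close>.
\<close>

definition left_mult_list :: "nat mat list \<Rightarrow> nat mat \<Rightarrow> nat mat" where
  "left_mult_list Xs A = foldr (*) Xs A"

definition right_mult_list :: "nat mat \<Rightarrow> nat mat list \<Rightarrow> nat mat" where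
  "right_mult_list A Ys = foldl (*) A Ys"

end

theory Submission
  imports Defs
begin

text \<open>
  With base-\<open>p\<close> digits, comparing two row values amounts to comparing the two rows
  lexicographically, and likewise for columns. If swapping rows \<open>k < l\<close> increases the row tuple,
  row \<open>l\<close> is larger than row \<open>k\<close>; at the first column where they differ, the swap moves the larger
  entry to the more significant position \<open>k\<close>, while all earlier columns are unchanged. So
  a single step already increases the column tuple, and chains follow by transitivity. Part (b)
  is the transposed statement.
\<close>

text \<open>Both lists have length \<open>n\<close>, so the proper-prefix case of the list order
  cannot occur and only a first differing position remains.\<close>

lemma map_upt_less_iff:
  fixes f g :: "nat \<Rightarrow> 'a::linorder"
  shows "map f [0..<n] < map g [0..<n] \<longleftrightarrow> (\<exists>i<n. f i < g i \<and> (\<forall>j<i. f j = g j))"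
proof -
  have "take i (map f [0..<n]) = take i (map g [0..<n]) \<longleftrightarrow> (\<forall>j<i. f j = g j)" if "i < n" for i
    using that by (auto simp: list_eq_iff_nth_eq)
  then show ?thesis
    by (auto simp: list_less_def lexord_take_index_conv)
qed

text \<open>The Horner step: it splits off the least significant digit, which is what the induction
  on the number of digits uses.\<close>

lemma digit_sum_Suc:
  fixes a :: "nat \<Rightarrow> 'a::comm_semiring_1"
  shows "(\<Sum>j<Suc m. a j * p ^ (Suc m - Suc j)) = p * (\<Sum>j<m. a j * p ^ (m - Suc j)) + a m"
proof -
  have "a j * p ^ (Suc m - Suc j) = p * (a j * p ^ (m - Suc j))" if "j < m" for j
  proof -
    have "Suc m - Suc j = Suc (m - Suc j)" using that by simp
    then show ?thesis by (simp only: power_Suc mult.left_commute)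
  qed
  then show ?thesis by (simp add: sum_distrib_left)
qed

text \<open>A lead of at least one in the higher digits is multiplied by \<open>p\<close> in the
  Horner step, and this outweighs the last digit \<open>a m < p\<close>, whatever \<open>b m\<close>
  is.\<close>

lemma digit_sum_less:
  fixes a b :: "nat \<Rightarrow> nat"
  assumes "\<forall>j<m. a j < p" and "j < m" "a j < b j" "\<forall>i<j. a i = b i"
  shows "(\<Sum>j<m. a j * p ^ (m - Suc j)) < (\<Sum>j<m. b j * p ^ (m - Suc j))"
  using assms
proof (induction m)
  case (Suc m)
  let ?S = "\<lambda>c. \<Sum>j<m. c j * p ^ (m - Suc j)"
  have "p * ?S a + a m < p * ?S b + b m"
  proof (cases "j = m")
    case True
    then have "?S a = ?S b" using Suc.prems by simp
    with True Suc.prems show ?thesis by simp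
  next
    case False
    then have "Suc (?S a) \<le> ?S b" using Suc by (simp add: Suc_le_eq)
    then have "p * Suc (?S a) \<le> p * ?S b" by (rule mult_le_mono2)
    moreover have "a m < p" using Suc.prems by simp
    ultimately show ?thesis by simp
  qed
  then show ?case by (simp only: digit_sum_Suc)
qed simp

lemma digit_sum_less_iff:
  fixes a b :: "nat \<Rightarrow> nat"
  assumes "\<forall>j<m. a j < p" "\<forall>j<m. b j < p"
  shows "(\<Sum>j<m. a j * p ^ (m - Suc j)) < (\<Sum>j<m. b j * p ^ (m - Suc j))
    \<longleftrightarrow> map a [0..<m] < map b [0..<m]"
    (is "?S a < ?S b \<longleftrightarrow> _")
proof -
  have less: "?S c < ?S d" if "map c [0..<m] < map d [0..<m]" "\<forall>j<m. c j < p" for c d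
    using that digit_sum_less[of m c p _ d] by (auto simp: map_upt_less_iff)
  have "?S a = ?S b" if "map a [0..<m] = map b [0..<m]"
    using that by (intro sum.cong) auto
  with less[of a b] less[of b a] assms show ?thesis
    \<comment> \<open>The converse direction comes from totality of the list order: equal or
      reversed digit lists would give equal or reversed sums.\<close>
    by (cases "map a [0..<m]" "map b [0..<m]" rule: linorder_cases) (auto simp del: map_eq_conv)
qed

lemma row_tuple_transpose: "row_tuple p A\<^sup>T = col_tuple p A"
  by (simp add: row_tuple_def col_tuple_def)

lemma col_tuple_transpose: "col_tuple p A\<^sup>T = row_tuple p A"
  by (simp add: row_tuple_def col_tuple_def)

lemma swaprows_commute: "swaprows k l A = swaprows l k A"
  by (intro eq_matI) auto

lemma swaprows_one_mult:
  fixes A :: "'a::semiring_1 mat"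
  assumes "A \<in> carrier_mat n m" "k < n" "l < n"
  shows "swaprows k l (1\<^sub>m n) * A = swaprows k l A"
proof (rule eq_matI)
  fix i j assume "i < dim_row (swaprows k l A)" "j < dim_col (swaprows k l A)"
  with assms show "(swaprows k l (1\<^sub>m n) * A) $$ (i, j) = swaprows k l A $$ (i, j)"
    by (auto simp: scalar_prod_def if_distrib[where f = "\<lambda>x. x * _"] sum.delta cong: if_cong)
qed (use assms in auto)

lemma transpose_swaprows_one:
  assumes "k < n" "l < n"
  shows "(swaprows k l (1\<^sub>m n))\<^sup>T = swaprows k l (1\<^sub>m n)"
  using assms by (intro eq_matI) auto

lemma swaprows_col_tuple_less:
  assumes A: "A \<in> carrier_mat n m" and p: "\<forall>i<n. \<forall>j<m. A $$ (i, j) < p"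
    and kl: "k < l" "l < n"
    and less: "row_tuple p A < row_tuple p (swaprows k l A)"
  shows "col_tuple p A < col_tuple p (swaprows k l A)"
proof -
  let ?B = "swaprows k l A"
  define x where "x i = (\<Sum>j<m. A $$ (i, j) * p ^ (m - Suc j))" for i
  let ?y = "\<lambda>M j. \<Sum>i<n. M $$ (i, j) * p ^ (n - Suc i)"
  have dims: "dim_row A = n" "dim_col A = m" using A by auto
  have rows: "row_tuple p A = map x [0..<n]"
    "row_tuple p ?B = map (x(k := x l, l := x k)) [0..<n]"
    using dims kl by (auto simp: row_tuple_def x_def)
  have "x k < x l"
  proof -
    obtain i where i: "i < n" "x i < (x(k := x l, l := x k)) i"
        "\<forall>j<i. x j = (x(k := x l, l := x k)) j"
      using less unfolding rows map_upt_less_iff by blast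
    \<comment> \<open>The swap alters the tuple at positions \<open>k\<close> and \<open>l\<close>
      only.\<close>
    then consider "i = k" | "i = l" by (metis fun_upd_other order.irrefl)
    then show ?thesis
    proof cases
      case 1 then show ?thesis using i(2) kl(1) by simp
    next
      case 2
      \<comment> \<open>A first difference at \<open>l\<close> would leave the earlier position
        \<open>k\<close> unchanged, forcing \<open>x k = x l\<close>, against
        \<open>i(2)\<close>.\<close>
      then have "x k = (x(k := x l, l := x k)) k" using i(3) kl(1) by blast
      then show ?thesis using i(2) kl(1) 2 by simp
    qed
  qed
  then obtain j where j: "j < m" "A $$ (k, j) < A $$ (l, j)" "\<forall>i<j. A $$ (k, i) = A $$ (l, i)"
    using digit_sum_less_iff[of m "\<lambda>j. A $$ (k, j)" p "\<lambda>j. A $$ (l, j)"] p kl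
    by (auto simp: x_def map_upt_less_iff)
  \<comment> \<open>Since \<open>k < l\<close>, row \<open>k\<close> is the first place where column
    \<open>j\<close> changes, and there the entry rises to that of row \<open>l\<close>.\<close>
  have "?y A j < ?y ?B j"
    by (rule digit_sum_less[where j = k]) (use p j kl dims in auto)
  \<comment> \<open>Left of \<open>j\<close>, rows \<open>k\<close> and \<open>l\<close> agree, so
    the swap has no effect.\<close>
  moreover have "?y A i = ?y ?B i" if "i < j" for i
    by (rule sum.cong) (use that j kl dims in auto)
  ultimately have "map (?y A) [0..<m] < map (?y ?B) [0..<m]"
    using \<open>j < m\<close> unfolding map_upt_less_iff by blast
  then show ?thesis using dims by (simp add: col_tuple_def)
qed

lemma transposition_mult_step:
  assumes A: "A \<in> carrier_mat n m" and p: "\<forall>i<n. \<forall>j<m. A $$ (i, j) < p"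
    and X: "transposition_matrix n X"
  shows "X * A \<in> carrier_mat n m" "\<forall>i<n. \<forall>j<m. (X * A) $$ (i, j) < p"
    "row_tuple p A < row_tuple p (X * A) \<Longrightarrow> col_tuple p A < col_tuple p (X * A)"
proof -
  \<comment> \<open>Swapping is symmetric in its two indices, so they may be taken in increasing
    order.\<close>
  obtain k l where kl: "k < l" "l < n" and "X = swaprows k l (1\<^sub>m n)"
    using X unfolding transposition_matrix_def by (metis linorder_neqE_nat swaprows_commute)
  then have XA: "X * A = swaprows k l A"
    using swaprows_one_mult[OF A] by simp
  show "X * A \<in> carrier_mat n m" "\<forall>i<n. \<forall>j<m. (X * A) $$ (i, j) < p"
    unfolding XA using A p kl by auto
  show "col_tuple p A < col_tuple p (X * A)" if "row_tuple p A < row_tuple p (X * A)"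
    using swaprows_col_tuple_less[OF A p kl] that unfolding XA by simp
qed

text \<open>Induction on the list peels off the outermost factor, the last one applied. Shape and
  digit bound are carried along because the single step needs them for each intermediate matrix; the
  empty product gives no strict increase.\<close>

lemma left_mult_list_chain:
  assumes A: "A \<in> carrier_mat n m" "\<forall>i<n. \<forall>j<m. A $$ (i, j) < p"
    and "\<forall>X\<in>set Xs. transposition_matrix n X"
    and "\<forall>k<length Xs. row_tuple p (left_mult_list (drop (Suc k) Xs) A)
                     < row_tuple p (left_mult_list (drop k Xs) A)"
  shows "left_mult_list Xs A \<in> carrier_mat n m \<and>
    (\<forall>i<n. \<forall>j<m. left_mult_list Xs A $$ (i, j) < p) \<and>
    (Xs \<noteq> [] \<longrightarrow> col_tuple p A < col_tuple p (left_mult_list Xs A))"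
  using assms(3,4)
proof (induction Xs)
  case Nil
  then show ?case using A by (simp add: left_mult_list_def)
next
  case (Cons X Xs)
  let ?B = "left_mult_list Xs A"
  have "\<forall>k<length Xs. row_tuple p (left_mult_list (drop (Suc k) Xs) A)
                     < row_tuple p (left_mult_list (drop k Xs) A)"
    using Cons.prems(2) by fastforce
  then have IH: "?B \<in> carrier_mat n m" "\<forall>i<n. \<forall>j<m. ?B $$ (i, j) < p"
    "Xs \<noteq> [] \<longrightarrow> col_tuple p A < col_tuple p ?B"
    using Cons by auto
  have "transposition_matrix n X" using Cons.prems(1) by simp
  note step = transposition_mult_step[OF IH(1,2) this]
  have X: "left_mult_list (X # Xs) A = X * ?B"
    by (simp add: left_mult_list_def)
  \<comment> \<open>The chain condition at index 0 compares the whole product with its tail.\<close>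
  have "row_tuple p ?B < row_tuple p (X * ?B)"
    using Cons.prems(2)[THEN spec, of 0] X by simp
  note less = step(3)[OF this]
  have "col_tuple p A < col_tuple p (X * ?B)"
  proof (cases "Xs = []")
    case True
    then show ?thesis using less by (simp add: left_mult_list_def)
  next
    case False
    then show ?thesis using IH(3) less by (blast intro: less_trans)
  qed
  then show ?case using step(1,2) X by simp
qed

text \<open>Transposing reverses a product, and transposition matrices are symmetric. This reduces
  part (b) to part (a) for the transposed matrix.\<close>

lemma transpose_right_mult_list:
  assumes "A \<in> carrier_mat n m" "\<forall>Y\<in>set Ys. transposition_matrix m Y"
  shows "(right_mult_list A Ys)\<^sup>T = left_mult_list (rev Ys) A\<^sup>T"
  using assms
proof (induction Ys arbitrary: A)
  case Nil
  then show ?case by (simp add: left_mult_list_def right_mult_list_def)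
next
  case (Cons Y Ys)
  then have Y: "Y \<in> carrier_mat m m" "Y\<^sup>T = Y"
    by (auto simp: transposition_matrix_def transpose_swaprows_one)
  then have "(A * Y)\<^sup>T = Y * A\<^sup>T"
    using Cons.prems(1) by (simp add: transpose_mult)
  moreover have "A * Y \<in> carrier_mat n m"
    using Cons.prems(1) Y(1) by simp
  ultimately show ?case
    using Cons.IH[of "A * Y"] Cons.prems(2)
    by (simp add: left_mult_list_def right_mult_list_def)
qed

theorem theorem2:
  fixes n m p :: nat and A :: "nat mat"
  assumes "n \<ge> 1" and "m \<ge> 1" and "p \<ge> 2"
    and "A \<in> carrier_mat n m"
    and "\<forall>i<n. \<forall>j<m. A $$ (i, j) < p"
  shows "(\<forall>Xs. Xs \<noteq> [] \<and> (\<forall>X\<in>set Xs. transposition_matrix n X) \<and>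
            (\<forall>k<length Xs. row_tuple p (left_mult_list (drop k Xs) A)
                         > row_tuple p (left_mult_list (drop (Suc k) Xs) A))
          \<longrightarrow> col_tuple p (left_mult_list Xs A) > col_tuple p A) \<and>
         (\<forall>Ys. Ys \<noteq> [] \<and> (\<forall>Y\<in>set Ys. transposition_matrix m Y) \<and>
            (\<forall>k<length Ys. col_tuple p (right_mult_list A (take (Suc k) Ys))
                         > col_tuple p (right_mult_list A (take k Ys)))
          \<longrightarrow> row_tuple p (right_mult_list A Ys) > row_tuple p A)"
proof (intro conjI allI impI; elim conjE)
  fix Xs
  assume "Xs \<noteq> []" "\<forall>X\<in>set Xs. transposition_matrix n X"
    "\<forall>k<length Xs. row_tuple p (left_mult_list (drop k Xs) A)
                 > row_tuple p (left_mult_list (drop (Suc k) Xs) A)"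
  then show "col_tuple p (left_mult_list Xs A) > col_tuple p A"
    using left_mult_list_chain[OF assms(4,5)] by blast
next
  fix Ys
  assume ne: "Ys \<noteq> []" and Ys: "\<forall>Y\<in>set Ys. transposition_matrix m Y"
    and chain: "\<forall>k<length Ys. col_tuple p (right_mult_list A (take (Suc k) Ys))
                            > col_tuple p (right_mult_list A (take k Ys))"
  \<comment> \<open>Suffixes of the reversed list are reversed prefixes of \<open>Ys\<close>, so the
    two chains consist of the same tuples.\<close>
  have row: "row_tuple p (left_mult_list (drop k (rev Ys)) A\<^sup>T)
      = col_tuple p (right_mult_list A (take (length Ys - k) Ys))" for k
  proof -
    have "\<forall>Y\<in>set (take (length Ys - k) Ys). transposition_matrix m Y"
      using Ys by (meson in_set_takeD)
    from transpose_right_mult_list[OF assms(4) this] show ?thesis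
      by (metis drop_rev row_tuple_transpose)
  qed
  have "row_tuple p (left_mult_list (drop (Suc k) (rev Ys)) A\<^sup>T)
      < row_tuple p (left_mult_list (drop k (rev Ys)) A\<^sup>T)" if "k < length (rev Ys)" for k
  proof -
    \<comment> \<open>Reversal turns the inequality at index \<open>k\<close> into the one at index
      \<open>length Ys - Suc k\<close> of the given chain.\<close>
    have "length Ys - k = Suc (length Ys - Suc k)" "length Ys - Suc k < length Ys"
      using that by auto
    then show ?thesis using chain unfolding row by metis
  qed
  moreover have "A\<^sup>T \<in> carrier_mat m n" "\<forall>i<m. \<forall>j<n. A\<^sup>T $$ (i, j) < p"
    using assms(4,5) by auto
  ultimately have "col_tuple p A\<^sup>T < col_tuple p (left_mult_list (rev Ys) A\<^sup>T)"
    using left_mult_list_chain[of "A\<^sup>T" m n p "rev Ys"] ne Ys by simp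
  then show "row_tuple p (right_mult_list A Ys) > row_tuple p A"
    using transpose_right_mult_list[OF assms(4) Ys] by (metis col_tuple_transpose)
qed

end
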